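(* For all $r,s\in \mathbb{N}$ and $d,\eta>0$, there exist $\rho,n_0>0$ such that every $(\rho,d)$-dense graph $G$ on $n \geq n_0$ vertices with $\delta(G)\geq (1/2+\eta)n$ contains the $r$th power of a Hamilton cycle. Moreover, for every integer $n'$ with $n-s\leq n' \leq n$, $G$ contains the $r$th power of a cycle covering precisely $n'$ vertices.
   Context: An $n$-vertex graph $G$ is $(\rho,d)$-dense if every $X \subseteq V(G)$ satisfies $e(G[X]) \geq d\binom{|X|}{2}-\rho n^2$. The $r$th power of a cycle $w_1\dots w_k$ is the graph on $\{w_1,\dots,w_k\}$ with edge set $\{w_iw_{i+j}: 1\le i\le k,\ j\in[r]\}$ (indices modulo $k$); equivalently it is obtained from the cycle by joining every pair of vertices at distance at most $r$ on the cycle. A Hamilton cycle is a cycle through all vertices of $G$. *)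

theory Defs
  imports Complex_Main
begin

type_synonym 'a graph = "'a set \<times> 'a set set"

abbreviation verts :: "'a graph \<Rightarrow> 'a set" where
  "verts G \<equiv> fst G"

abbreviation edges :: "'a graph \<Rightarrow> 'a set set" where
  "edges G \<equiv> snd G"

definition simple_graph :: "'a graph \<Rightarrow> bool" where
  "simple_graph G \<longleftrightarrow> finite (verts G) \<and> (\<forall>e\<in>edges G. e \<subseteq> verts G \<and> card e = 2)"

definition subgraph :: "'a graph \<Rightarrow> 'a graph \<Rightarrow> bool" where
  "subgraph H G \<longleftrightarrow> verts H \<subseteq> verts G \<and> edges H \<subseteq> edges G"

definition induced_subgraph :: "'a graph \<Rightarrow> 'a set \<Rightarrow> 'a graph" where
  "induced_subgraph G X = (X, {e \<in> edges G. e \<subseteq> X})"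

definition degree :: "'a graph \<Rightarrow> 'a \<Rightarrow> nat" where
  "degree G v = card {e \<in> edges G. v \<in> e}"

text \<open>Meaningful only for graphs with at least one vertex (and finitely many).\<close>

definition min_degree :: "'a graph \<Rightarrow> nat" where
  "min_degree G = Min (degree G ` verts G)"

definition dense_graph :: "real \<Rightarrow> real \<Rightarrow> 'a graph \<Rightarrow> bool" where
  "dense_graph \<rho> d G \<longleftrightarrow>
     (\<forall>X \<subseteq> verts G.
        real (card (edges (induced_subgraph G X)))
          \<ge> d * real (card X choose 2) - \<rho> * (real (card (verts G)))\<^sup>2)"

text \<open>A cycle is given by the list of its vertices in cyclic order, indexed from 0.\<close>

definition is_cycle :: "'a graph \<Rightarrow> 'a list \<Rightarrow> bool" where
  "is_cycle G ws \<longleftrightarrow>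
     length ws \<ge> 3 \<and> distinct ws \<and> set ws \<subseteq> verts G \<and>
     (\<forall>i < length ws. {ws ! i, ws ! (Suc i mod length ws)} \<in> edges G)"

definition hamilton_cycle :: "'a graph \<Rightarrow> 'a list \<Rightarrow> bool" where
  "hamilton_cycle G ws \<longleftrightarrow> is_cycle G ws \<and> set ws = verts G"

text \<open>The condition \<open>(i + j) mod length ws \<noteq> i\<close> only discards the loops that would arise when
  \<open>r \<ge> length ws\<close>; the edges are then exactly the pairs of distinct vertices at distance at
  most \<open>r\<close> on the cycle.\<close>

definition cycle_power :: "nat \<Rightarrow> 'a list \<Rightarrow> 'a graph" where
  "cycle_power r ws =
     (set ws,
      {{ws ! i, ws ! ((i + j) mod length ws)} | i j.
         i < length ws \<and> j \<in> {1..r} \<and> (i + j) mod length ws \<noteq> i})"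

end

theory Submission
  imports Defs "HOL-Library.Disjoint_Sets"
begin

text \<open>
  Local density forces an \<open>M\<close>-clique inside every set of at least \<open>\<epsilon>n\<close> vertices, for any fixed \<open>M\<close>,
  so all but \<open>\<epsilon>n\<close> vertices can be tiled by disjoint \<open>M\<close>-cliques; no regularity lemma is needed.
  Since vertices have degree at least \<open>n/2\<close>, pigeonholing inside a tile yields two disjoint
  \<open>r\<close>-subsets (its ends) with \<open>\<alpha>n\<close> common neighbours each, where \<open>\<alpha>\<close> depends on \<open>r\<close> only.
  Let \<open>X\<close> and \<open>Y\<close> be the common neighbourhoods of two ends of different tiles.
  As the degrees exceed \<open>(1/2 + \<eta>)n\<close>, linearly many vertices have a positive proportion of both \<open>X\<close>
  and \<open>Y\<close> as neighbours. A large clique of such vertices contains an \<open>r\<close>-clique \<open>Q\<close> with linearly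
  many common neighbours in both \<open>X\<close> and \<open>Y\<close>, and \<open>r\<close>-cliques in these common neighbourhoods,
  together with \<open>Q\<close>, link the two ends by \<open>3r\<close> vertices.

  These connecting vertices may be taken out of the interiors of other tiles, since a tile stays a
  clique whatever it loses. About \<open>3rn/M\<close> vertices are lost in total, so every vertex \<open>v\<close> outside the
  tiles still has \<open>2r\<close> interior neighbours in linearly many tiles, and \<open>v\<close> can be inserted between
  \<open>r\<close> of them and \<open>r\<close> others. As \<open>\<epsilon>\<close> is far below \<open>1/M\<close>, each such \<open>v\<close> gets a tile of its own.
  For shorter cycles, discard vertices first: the argument only uses the cliques and the degrees,
  both of which survive the loss of \<open>s\<close> vertices.
\<close>

section \<open>Power paths as lists: gluing and closing up\<close>

text \<open>The list may repeat vertices: a cyclic power path \<open>ws\<close> is encoded as the power path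
  \<open>ws @ take r ws\<close>.\<close>

definition power_path :: "('a \<Rightarrow> 'a \<Rightarrow> bool) \<Rightarrow> nat \<Rightarrow> 'a list \<Rightarrow> bool" where
  "power_path E r xs \<longleftrightarrow>
     (\<forall>i j. i < j \<and> j < length xs \<and> j \<le> i + r \<longrightarrow> E (xs ! i) (xs ! j))"

lemma power_path_clique:
  assumes "pairwise E (set xs)" "distinct xs"
  shows "power_path E r xs"
  using assms unfolding power_path_def pairwise_def
  by (metis nat_neq_iff nth_eq_iff_index_eq nth_mem order_less_trans)

text \<open>The overlap \<open>ms\<close> has at least \<open>r\<close> entries, so two positions at
  distance at most \<open>r\<close> lie both in \<open>xs @ ms\<close> or both in
  \<open>ms @ ys\<close>.\<close>

lemma power_path_join:
  assumes "power_path E r (xs @ ms)" "power_path E r (ms @ ys)" "r \<le> length ms"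
  shows "power_path E r (xs @ ms @ ys)"
  unfolding power_path_def
proof (intro allI impI, elim conjE)
  fix i j assume ij: "i < j" "j < length (xs @ ms @ ys)" "j \<le> i + r"
  show "E ((xs @ ms @ ys) ! i) ((xs @ ms @ ys) ! j)"
  proof (cases "j < length (xs @ ms)")
    case True
    then have "E ((xs @ ms) ! i) ((xs @ ms) ! j)"
      using assms(1) ij unfolding power_path_def by blast
    moreover have "(xs @ ms @ ys) ! k = (xs @ ms) ! k" if "k < length (xs @ ms)" for k
      using that nth_append[of "xs @ ms" ys k] by simp
    ultimately show ?thesis using True ij by simp
  next
    case False
    then have "length xs \<le> i" using assms(3) ij by simp
    then have "E ((ms @ ys) ! (i - length xs)) ((ms @ ys) ! (j - length xs))"
      using assms(2) ij False by (auto intro!: assms(2)[unfolded power_path_def, rule_format])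
    then show ?thesis using \<open>length xs \<le> i\<close> ij by (simp add: nth_append[of xs])
  qed
qed

text \<open>Each \<open>a i\<close> ends one piece and starts the next, hence can serve as the
  overlap in \<open>power_path_join\<close>. The final \<open>a k\<close> stays visible so that it
  can later be identified with the first block, which closes the cycle.\<close>

lemma power_path_concat:
  assumes step: "\<And>i. i < k \<Longrightarrow> power_path E r (a i @ S i @ a (Suc i))"
    and len: "\<And>i. r \<le> length (a i)"
    and "0 < k"
  shows "power_path E r (concat (map (\<lambda>i. a i @ S i) [0..<k]) @ a k)"
  using \<open>0 < k\<close> step
proof (induction k)
  case (Suc k)
  show ?case
  proof (cases "k = 0")
    case True
    with Suc.prems show ?thesis by simp
  next
    case False
    then have "power_path E r (concat (map (\<lambda>i. a i @ S i) [0..<k]) @ a k)"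
      using Suc by simp
    moreover have "power_path E r (a k @ S k @ a (Suc k))"
      using Suc.prems by simp
    ultimately show ?thesis
      using power_path_join[OF _ _ len[of k], where xs = "concat (map (\<lambda>i. a i @ S i) [0..<k])"
          and ys = "S k @ a (Suc k)"] by simp
  qed
qed simp

lemma cycle_of_power_path:
  assumes "power_path E r (ws @ take r ws)" "r \<le> length ws"
    and "i < length ws" "j \<in> {1..r}"
  shows "E (ws ! i) (ws ! ((i + j) mod length ws))"
proof -
  have "E ((ws @ take r ws) ! i) ((ws @ take r ws) ! (i + j))"
    using assms unfolding power_path_def by auto
  moreover have "(ws @ take r ws) ! (i + j) = ws ! ((i + j) mod length ws)"
  proof (cases "i + j < length ws")
    case False
    then have "(i + j) mod length ws = i + j - length ws"
      using assms by (simp add: mod_if)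
    then show ?thesis using assms False by (simp add: nth_append)
  qed (simp add: nth_append)
  ultimately show ?thesis using assms by (simp add: nth_append)
qed

lemma distinct_concat_upt:
  assumes "\<And>i. i < k \<Longrightarrow> distinct (S i)"
    and "\<And>i j. i < j \<Longrightarrow> j < k \<Longrightarrow> set (S i) \<inter> set (S j) = {}"
  shows "distinct (concat (map S [0..<k]))"
  using assms by (induction k) fastforce+

section \<open>Double counting, pigeonhole and greedy choice\<close>

lemma sum_card_swap:
  assumes "finite A" "finite B"
  shows "(\<Sum>a\<in>A. card {b \<in> B. R a b}) = (\<Sum>b\<in>B. card {a \<in> A. R a b})"
proof -
  have "(\<Sum>a\<in>A. card {b \<in> B. R a b}) = (\<Sum>a\<in>A. \<Sum>b\<in>B. if R a b then 1 else 0)"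
    using assms by (simp add: sum.If_cases Int_def)
  also have "\<dots> = (\<Sum>b\<in>B. \<Sum>a\<in>A. if R a b then 1 else 0)"
    by (rule sum.swap)
  also have "\<dots> = (\<Sum>b\<in>B. card {a \<in> A. R a b})"
    using assms by (simp add: sum.If_cases Int_def)
  finally show ?thesis .
qed

text \<open>By double counting, at least \<open>c / 2 * card P\<close> points of \<open>P\<close>
  have \<open>r\<close> or more elements of \<open>K\<close> related to them. Each such point picks
  out an \<open>r\<close>-subset of \<open>K\<close>. There are at most \<open>2 ^ card K\<close> of
  these, so one of them is picked often enough.\<close>

lemma popular_subset:
  fixes R :: "'a \<Rightarrow> 'b \<Rightarrow> bool" and c :: real
  assumes fin: "finite K" "finite P"
    and deg: "\<And>z. z \<in> K \<Longrightarrow> real (card {p \<in> P. R z p}) \<ge> c * card P"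
    and r: "0 < r" "2 * real r \<le> c * card K" and c: "0 < c" "c \<le> 1"
  shows "\<exists>Q\<subseteq>K. card Q = r \<and>
           real (card {p \<in> P. \<forall>q\<in>Q. R q p}) \<ge> c / 2 ^ (card K + 1) * card P"
proof (rule ccontr)
  define x where "x = c / 2 ^ (card K + 1) * card P"
  define Qs where "Qs = {Q. Q \<subseteq> K \<and> card Q = r}"
  define S where "S = {p \<in> P. r \<le> card {z \<in> K. R z p}}"
  assume "\<not> ?thesis"
  then have small: "real (card {p \<in> P. \<forall>q\<in>Q. R q p}) < x" if "Q \<in> Qs" for Q
    using that unfolding x_def Qs_def by force
  have "c * real (card K) \<le> 1 * real (card K)" using c by (intro mult_right_mono) auto
  then have rK: "real r \<le> card K" and K: "0 < card K" using r by linarith+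
  have finQs: "finite Qs" unfolding Qs_def using fin by auto
  have Qs0: "Qs \<noteq> {}" unfolding Qs_def
    using obtain_subset_with_card_n[of r K] rK by auto
  have cardQs: "card Qs \<le> 2 ^ card K"
    using card_mono[of "Pow K" Qs] fin by (auto simp: Qs_def card_Pow)
  have finS: "finite S" unfolding S_def using fin by auto
  have SP: "S \<subseteq> P" unfolding S_def by auto
  have "c * card K * card P = (\<Sum>z\<in>K. c * card P)" by simp
  also have "\<dots> \<le> (\<Sum>z\<in>K. real (card {p \<in> P. R z p}))"
    by (intro sum_mono deg)
  also have "\<dots> = real (\<Sum>p\<in>P. card {z \<in> K. R z p})"
    using sum_card_swap[OF fin, of R] by (simp only: of_nat_sum[symmetric])
  also have "\<dots> = (\<Sum>p\<in>P. real (card {z \<in> K. R z p}))" by simp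
  \<comment> \<open>A point of \<open>S\<close> contributes at most \<open>card K\<close> and any
    other point less than \<open>r\<close>.\<close>
  also have "\<dots> \<le> (\<Sum>p\<in>P. (if p \<in> S then real (card K) else 0) + real r)"
  proof (rule sum_mono)
    fix p assume "p \<in> P"
    have "card {z \<in> K. R z p} \<le> card K" using fin by (intro card_mono) auto
    then show "real (card {z \<in> K. R z p}) \<le> (if p \<in> S then real (card K) else 0) + real r"
      using \<open>p \<in> P\<close> unfolding S_def by auto
  qed
  also have "\<dots> = card S * card K + real r * card P"
    using fin SP by (simp add: sum.distrib sum.If_cases Int_absorb1)
  finally have "c * card K * card P \<le> card S * card K + real r * card P" .
  \<comment> \<open>The charge of \<open>r\<close> per point consumes at most half of the
    total.\<close>
  moreover have "2 * real r * card P \<le> c * card K * card P"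
    using r by (intro mult_right_mono) auto
  ultimately have "(c * card P / 2) * card K \<le> card S * card K" by (simp add: algebra_simps)
  then have lower: "c * card P / 2 \<le> card S" using K by simp
  have "S \<subseteq> (\<Union>Q\<in>Qs. {p \<in> P. \<forall>q\<in>Q. R q p})"
  proof
    fix p assume "p \<in> S"
    then have "r \<le> card {z \<in> K. R z p}" unfolding S_def by blast
    then obtain Q where "Q \<subseteq> {z \<in> K. R z p}" "card Q = r"
      by (rule obtain_subset_with_card_n)
    then show "p \<in> (\<Union>Q\<in>Qs. {p \<in> P. \<forall>q\<in>Q. R q p})"
      using \<open>p \<in> S\<close> unfolding Qs_def S_def by blast
  qed
  then have "card S \<le> card (\<Union>Q\<in>Qs. {p \<in> P. \<forall>q\<in>Q. R q p})"
    using fin finQs by (intro card_mono) auto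
  also have "\<dots> \<le> (\<Sum>Q\<in>Qs. card {p \<in> P. \<forall>q\<in>Q. R q p})"
    by (rule card_UN_le[OF finQs])
  finally have "real (card S) \<le> (\<Sum>Q\<in>Qs. real (card {p \<in> P. \<forall>q\<in>Q. R q p}))"
    by (simp only: of_nat_le_iff of_nat_sum[symmetric])
  also have "\<dots> < (\<Sum>Q\<in>Qs. x)" using finQs Qs0 small by (intro sum_strict_mono) auto
  also have "\<dots> = real (card Qs) * x" by simp
  also have "\<dots> \<le> 2 ^ card K * x"
    using cardQs c by (intro mult_right_mono) (auto simp: x_def simp flip: of_nat_le_iff)
  also have "\<dots> = c * card P / 2" by (simp add: x_def)
  finally show False using lower by simp
qed

text \<open>One index is treated at a time, with \<open>D\<close> and all earlier choices forbidden.
  The last choice faces only \<open>card L - 1\<close> earlier sets, whence the slack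
  \<open>m\<close> in the size condition. With singletons for \<open>A\<close> this becomes an
  injective choice.\<close>

lemma greedy_disjoint_choice:
  assumes "finite L"
    and ex: "\<And>v W. v \<in> L \<Longrightarrow> finite W \<Longrightarrow> card W \<le> w \<Longrightarrow> \<exists>x. P v x \<and> A x \<inter> W = {}"
    and size: "\<And>v x. P v x \<Longrightarrow> finite (A x) \<and> card (A x) \<le> m"
    and D: "finite D" "card D + m * card L \<le> w + m"
  shows "\<exists>f. (\<forall>v\<in>L. P v (f v) \<and> A (f v) \<inter> D = {}) \<and> disjoint_family_on (A \<circ> f) L"
  using assms(1) D(2) ex
proof (induction L rule: finite_induct)
  case empty
  then show ?case by (simp add: disjoint_family_on_def)
next
  case (insert v L)
  have "\<exists>f. (\<forall>v\<in>L. P v (f v) \<and> A (f v) \<inter> D = {}) \<and> disjoint_family_on (A \<circ> f) L"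
    using insert by (intro insert.IH) auto
  then obtain f where f: "\<And>v. v \<in> L \<Longrightarrow> P v (f v)" "\<And>v. v \<in> L \<Longrightarrow> A (f v) \<inter> D = {}"
    "disjoint_family_on (A \<circ> f) L" by auto
  define W where "W = D \<union> (\<Union>u\<in>L. A (f u))"
  have "card (\<Union>u\<in>L. A (f u)) \<le> (\<Sum>u\<in>L. card (A (f u)))"
    using insert.hyps by (intro card_UN_le)
  also have "\<dots> \<le> (\<Sum>u\<in>L. m)" using f(1) size by (intro sum_mono) auto
  finally have "card W \<le> card D + m * card L"
    using card_Un_le[of D "\<Union>u\<in>L. A (f u)"] unfolding W_def by (simp add: mult.commute)
  then have "card W \<le> w" using insert.prems(1) insert.hyps by simp
  moreover have "finite W" unfolding W_def using D(1) insert.hyps f(1) size by blast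
  ultimately obtain x where x: "P v x" "A x \<inter> W = {}" using insert.prems(2) by blast
  have "P u ((f(v := x)) u) \<and> A ((f(v := x)) u) \<inter> D = {}" if "u \<in> insert v L" for u
    using that f x unfolding W_def by auto
  moreover have "disjoint_family_on (A \<circ> f(v := x)) (insert v L)"
    unfolding disjoint_family_on_def
  proof (intro ballI impI)
    fix u u' assume "u \<in> insert v L" "u' \<in> insert v L" "u \<noteq> u'"
    moreover have "A (f u) \<inter> A x = {}" if "u \<in> L" for u
      using that x(2) unfolding W_def by blast
    moreover have "A (f u) \<inter> A (f u') = {}" if "u \<in> L" "u' \<in> L"
      using that f(3) \<open>u \<noteq> u'\<close> by (simp add: disjoint_family_on_def)
    ultimately show "(A \<circ> f(v := x)) u \<inter> (A \<circ> f(v := x)) u' = {}"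
      using insert.hyps by (auto split: if_splits)
  qed
  ultimately show ?case by (intro exI[of _ "f(v := x)"] conjI ballI) blast+
qed

section \<open>Linking two cliques in a graph of large minimum degree\<close>

locale relation_graph =
  fixes V :: "'a set" and E :: "'a \<Rightarrow> 'a \<Rightarrow> bool"
  assumes finite_V: "finite V"
    and sym: "E u v \<Longrightarrow> E v u"
    and irrefl: "\<not> E u u"
begin

abbreviation common_nbrs :: "'a set \<Rightarrow> 'a set \<Rightarrow> 'a set" where
  "common_nbrs Q A \<equiv> {u \<in> A. \<forall>q\<in>Q. E q u}"

lemma power_path_two_cliques:
  assumes "pairwise E (set xs)" "pairwise E (set ys)" "set ys \<subseteq> common_nbrs (set xs) A"
    and "distinct xs" "distinct ys"
  shows "power_path E r (xs @ ys)"
proof (rule power_path_clique)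
  show "pairwise E (set (xs @ ys))"
    using assms(1-3) sym unfolding pairwise_def by auto
  show "distinct (xs @ ys)" using assms(3-5) irrefl by auto
qed

text \<open>The pairs between \<open>X\<close> and \<open>V\<close> are counted from both sides. The
  exceptional set stays below half of \<open>V\<close> by a margin, so the exceptional sets of two
  different targets together still leave a fraction \<open>3 * \<eta> / 2\<close> of
  \<open>V\<close>.\<close>

lemma many_rich_vertices:
  fixes \<eta> :: real
  assumes deg: "\<And>v. v \<in> V \<Longrightarrow> real (card {u \<in> V. E v u}) \<ge> (1/2 + \<eta>) * card V"
    and X: "X \<subseteq> V" "X \<noteq> {}" and \<eta>: "0 < \<eta>"
  shows "real (card {z \<in> V. real (card {x \<in> X. E z x}) < \<eta> / 4 * card X}) \<le> (1/2 - 3 * \<eta> / 4) * card V"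
proof -
  define B where "B = {z \<in> V. real (card {x \<in> X. E z x}) < \<eta> / 4 * card X}"
  have finX: "finite X" and BV: "B \<subseteq> V" and finB: "finite B"
    using X finite_V by (auto simp: B_def intro: finite_subset)
  have cardX: "card X > 0" using finX X by auto
  have "(1/2 + \<eta>) * card V * card X = (\<Sum>x\<in>X. (1/2 + \<eta>) * card V)" by simp
  also have "\<dots> \<le> (\<Sum>x\<in>X. real (card {u \<in> V. E x u}))" using deg X by (intro sum_mono) auto
  also have "\<dots> = real (\<Sum>u\<in>V. card {x \<in> X. E x u})"
    using sum_card_swap[OF finX finite_V, of E] by (simp only: of_nat_sum[symmetric])
  also have "\<dots> = (\<Sum>u\<in>V. real (card {x \<in> X. E u x}))"
    using sym by (auto intro!: sum.cong arg_cong[where f = card])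
  also have "\<dots> \<le> (\<Sum>u\<in>V. (if u \<in> B then 0 else real (card X)) + \<eta> / 4 * card X)"
  proof (rule sum_mono)
    fix u assume "u \<in> V"
    have "card {x \<in> X. E u x} \<le> card X" using finX by (intro card_mono) auto
    then show "real (card {x \<in> X. E u x}) \<le> (if u \<in> B then 0 else real (card X)) + \<eta> / 4 * card X"
      using \<open>u \<in> V\<close> \<eta> unfolding B_def by (auto simp: add_increasing2)
  qed
  also have "\<dots> = real (card (V - B)) * card X + card V * (\<eta> / 4 * card X)"
    using finite_V by (simp add: sum.distrib sum.If_cases set_diff_eq Int_def)
  also have "\<dots> = (card V - card B + card V * (\<eta> / 4)) * real (card X)"
    using card_mono[OF finite_V BV] by (simp add: card_Diff_subset[OF finB BV] of_nat_diff algebra_simps)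
  finally have "(1/2 + \<eta>) * card V \<le> card V - real (card B) + card V * (\<eta> / 4)"
    using cardX card_mono[OF finite_V BV] by (simp add: of_nat_diff)
  then show ?thesis unfolding B_def[symmetric] by (simp add: algebra_simps)
qed

text \<open>The route visits \<open>b\<close>, \<open>KX\<close>, \<open>Q\<close>,
  \<open>KY\<close>, \<open>a\<close> in this order. Consecutive cliques are completely joined, so
  each pair of them forms a power path, and these are glued along overlaps of length
  \<open>r\<close>. The set \<open>W\<close> holds the vertices already in use.\<close>

lemma connecting_path:
  fixes \<eta> \<alpha> \<gamma> \<epsilon> :: real
  assumes deg: "\<And>v. v \<in> V \<Longrightarrow> real (card {u \<in> V. E v u}) \<ge> (1/2 + \<eta>) * card V"
    and cliques: "\<And>X. X \<subseteq> V \<Longrightarrow> real (card X) \<ge> \<epsilon> * card V \<Longrightarrow>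
      \<exists>K\<subseteq>X. card K = M \<and> pairwise E K"
    and r: "0 < r" "real r \<le> \<epsilon> * card V"
    and params: "0 < \<eta>" "\<eta> \<le> 1/2" "0 < \<alpha>" "0 < \<epsilon>" "2 * real r \<le> \<eta> / 4 * real R" "2 * real R \<le> \<eta> / 4 * real M"
      "\<epsilon> \<le> \<eta>" "\<epsilon> \<le> \<eta> * \<alpha> / 2 ^ (M + 5)"
    and W: "real (card W) \<le> \<alpha> / 2 * card V" "real (card W) \<le> \<eta> / 2 * card V" "finite W"
    and b: "pairwise E (set b)" "distinct b" "real (card (common_nbrs (set b) V)) \<ge> \<alpha> * card V"
    and a: "pairwise E (set a)" "distinct a" "real (card (common_nbrs (set a) V)) \<ge> \<alpha> * card V"
    and len: "length a = r" "length b = r"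
  shows "\<exists>c. length c = 3 * r \<and> distinct c \<and> set c \<subseteq> V - W \<and> power_path E r (b @ c @ a)"
proof -
  define n where "n = card V"
  have n: "0 < n" using r params unfolding n_def by (cases "card V = 0") auto
  define c where "c = \<eta> / 4"
  have c: "0 < c" "c \<le> 1" using params by (auto simp: c_def)
  have sub_clique: "\<exists>K\<subseteq>X. card K = k \<and> pairwise E K"
    if "X \<subseteq> V" "real (card X) \<ge> \<epsilon> * n" "k \<le> M" for X k
    using cliques[OF that(1)] that(2,3) unfolding n_def
    by (metis obtain_subset_with_card_n order_trans pairwise_subset)
  have half: "real (card (X - W)) \<ge> \<alpha> / 2 * n" if "real (card X) \<ge> \<alpha> * n" for X
  proof -
    have "card X \<le> card (X - W) + card W" using diff_card_le_card_Diff[OF W(3), of X] by simp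
    then show ?thesis using that W(1) unfolding n_def by simp
  qed
  define X where "X = common_nbrs (set b) V - W"
  define Y where "Y = common_nbrs (set a) V - W"
  have X: "X \<subseteq> V" "real (card X) \<ge> \<alpha> / 2 * n" using half b(3) unfolding X_def n_def by auto
  have Y: "Y \<subseteq> V" "real (card Y) \<ge> \<alpha> / 2 * n" using half a(3) unfolding Y_def n_def by auto
  have XY: "finite X" "finite Y" using X Y finite_V finite_subset by auto
  have "0 < \<alpha> / 2 * n" using params n by simp
  then have ne: "X \<noteq> {}" "Y \<noteq> {}" using X Y by auto
  define BX where "BX = {z \<in> V. real (card {x \<in> X. E z x}) < \<eta> / 4 * card X}"
  define BY where "BY = {z \<in> V. real (card {x \<in> Y. E z x}) < \<eta> / 4 * card Y}"
  have B: "real (card BX) \<le> (1/2 - 3 * \<eta> / 4) * n" "real (card BY) \<le> (1/2 - 3 * \<eta> / 4) * n"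
    using many_rich_vertices[OF deg X(1) ne(1) params(1)] many_rich_vertices[OF deg Y(1) ne(2) params(1)]
    unfolding BX_def BY_def n_def by auto
  \<comment> \<open>Two exceptional sets of at most \<open>(1/2 - 3 * \<eta> / 4) * n\<close>
    vertices each and at most \<open>\<eta> / 2 * n\<close> vertices of \<open>W\<close> leave at
    least \<open>\<eta> * n\<close> vertices.\<close>
  define Z where "Z = V - (BX \<union> BY \<union> W)"
  have "n \<le> card Z + card (BX \<union> BY \<union> W)"
    using diff_card_le_card_Diff[of "BX \<union> BY \<union> W" V] W(3) finite_V
    unfolding Z_def n_def BX_def BY_def by simp
  also have "\<dots> \<le> card Z + (card BX + card BY + card W)"
    using card_Un_le[of "BX \<union> BY" W] card_Un_le[of BX BY] by linarith
  finally have "real n \<le> card Z + (real (card BX) + card BY + card W)" by linarith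
  then have "real (card Z) \<ge> \<eta> * n" using B W(2) unfolding n_def by (simp add: algebra_simps)
  moreover have "\<epsilon> * n \<le> \<eta> * n" using params by (intro mult_right_mono) auto
  ultimately obtain K where K: "K \<subseteq> Z" "card K = M" "pairwise E K"
    using sub_clique[of Z M] unfolding Z_def by force
  have ZV: "Z \<subseteq> V" "Z \<inter> W = {}" unfolding Z_def by auto
  have finK: "finite K" using K ZV finite_V finite_subset by metis
  have "\<eta> / 4 * real k \<le> real k" for k using params mult_right_mono[of "\<eta>/4" 1 "real k"] by simp
  then have RM: "2 * real r \<le> R" "2 * real R \<le> M" using params by (meson order_trans)+
  then have R: "0 < R" "R \<le> M" "r \<le> M" using r by linarith+
  \<comment> \<open>One use of \<open>popular_subset\<close> controls one target set only. So first
    \<open>R\<close> vertices with many common neighbours in \<open>X\<close> are found, then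
    \<open>r\<close> among them for \<open>Y\<close>; passing to a subset keeps the common
    neighbours in \<open>X\<close>.\<close>
  obtain Q1 where Q1: "Q1 \<subseteq> K" "card Q1 = R"
      "real (card (common_nbrs Q1 X)) \<ge> c / 2 ^ (M + 1) * card X"
    using popular_subset[OF finK XY(1), where R = E and c = c and r = R] K params R c
    unfolding Z_def BX_def c_def by force
  have finQ1: "finite Q1" using Q1 finK finite_subset by metis
  obtain Q where Q: "Q \<subseteq> Q1" "card Q = r"
      "real (card (common_nbrs Q Y)) \<ge> c / 2 ^ (R + 1) * card Y"
    using popular_subset[OF finQ1 XY(2), where R = E and c = c and r = r] K Q1 params r c
    unfolding Z_def BY_def c_def by force
  \<comment> \<open>In the exponent \<open>M + 5\<close>, the five collects \<open>1/4\<close> from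
    \<open>c\<close>, \<open>1/2\<close> from \<open>popular_subset\<close>, \<open>1/2\<close> from
    \<open>\<alpha> / 2\<close> and the factor \<open>2\<close> on the left. That last factor leaves
    room to remove \<open>KX\<close>, of size \<open>r \<le> \<epsilon> * n\<close>, before
    \<open>KY\<close> is chosen.\<close>
  have big: "2 * (\<epsilon> * n) \<le> c / 2 ^ (k + 1) * card U" if "k \<le> M" "real (card U) \<ge> \<alpha> / 2 * n" for k and U :: "'a set"
  proof -
    have "2 * (\<epsilon> * n) \<le> 2 * (\<eta> * \<alpha> / 2 ^ (M + 5) * n)" using params by (intro mult_mono) auto
    also have "\<dots> = c / 2 ^ (M + 1) * (\<alpha> / 2 * n)" by (simp add: c_def power_add)
    also have "\<dots> \<le> c / 2 ^ (k + 1) * card U"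
      using that c params by (intro mult_mono divide_left_mono power_increasing) auto
    finally show ?thesis .
  qed
  have QX: "real (card (common_nbrs Q X)) \<ge> 2 * (\<epsilon> * n)"
  proof -
    have "card (common_nbrs Q1 X) \<le> card (common_nbrs Q X)" using XY Q by (intro card_mono) auto
    then show ?thesis using Q1(3) big[OF _ X(2), of M] by simp
  qed
  moreover have "0 < \<epsilon> * n" using params n by simp
  ultimately have "real (card (common_nbrs Q X)) \<ge> \<epsilon> * n" by linarith
  moreover have "common_nbrs Q X \<subseteq> V" using X by auto
  ultimately obtain KX where KX: "KX \<subseteq> common_nbrs Q X" "card KX = r" "pairwise E KX"
    using sub_clique R by meson
  have finKX: "finite KX" using KX(2) r by (metis card.infinite less_irrefl)
  have "card (common_nbrs Q Y) \<le> card (common_nbrs Q Y - KX) + r"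
    using diff_card_le_card_Diff[OF finKX, of "common_nbrs Q Y"] KX by simp
  then have "real (card (common_nbrs Q Y - KX)) \<ge> \<epsilon> * n"
    using Q(3) big[OF R(2) Y(2)] r unfolding n_def by linarith
  moreover have "common_nbrs Q Y - KX \<subseteq> V" using Y by auto
  ultimately obtain KY where KY: "KY \<subseteq> common_nbrs Q Y - KX" "card KY = r" "pairwise E KY"
    using sub_clique R by meson
  have finKY: "finite KY" and finQ: "finite Q" using KY(2) Q(2) r by (metis card.infinite less_irrefl)+
  obtain x q y where xqy: "set x = KX" "distinct x" "set q = Q" "distinct q" "set y = KY" "distinct y"
    using finite_distinct_list[OF finKX] finite_distinct_list[OF finKY] finite_distinct_list[OF finQ]
    by blast
  have pQ: "pairwise E Q" using K(3) Q Q1 by (meson pairwise_subset)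
  have lens: "length x = r" "length q = r" "length y = r"
    using xqy KX KY Q distinct_card by metis+
  have QV: "Q \<subseteq> V - W" using Q Q1 K ZV by blast
  have "set x \<subseteq> common_nbrs (set b) V" using xqy KX unfolding X_def by blast
  moreover have "set q \<subseteq> common_nbrs (set x) V" using xqy KX QV sym by blast
  moreover have "set y \<subseteq> common_nbrs (set q) V" using xqy KY Y(1) by blast
  moreover have "set a \<subseteq> common_nbrs (set y) UNIV" using xqy KY sym unfolding Y_def by blast
  ultimately have adj: "set x \<subseteq> common_nbrs (set b) V" "set q \<subseteq> common_nbrs (set x) V"
    "set y \<subseteq> common_nbrs (set q) V" "set a \<subseteq> common_nbrs (set y) UNIV" .
  have p1: "power_path E r (b @ x)"
    using power_path_two_cliques[OF _ _ adj(1)] b KX xqy by auto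
  have p2: "power_path E r (x @ q)"
    using power_path_two_cliques[OF _ _ adj(2)] KX xqy pQ by auto
  have p3: "power_path E r (q @ y)"
    using power_path_two_cliques[OF _ _ adj(3)] KY xqy pQ by auto
  have p4: "power_path E r (y @ a)"
    using power_path_two_cliques[OF _ _ adj(4)] KY xqy a by auto
  have "power_path E r (b @ (x @ q @ y) @ a)"
    using power_path_join[OF p1, of "q @ y @ a"] power_path_join[OF p2, of "y @ a"]
      power_path_join[OF p3 p4] lens by simp
  have "KX \<inter> Q = {}" "KY \<inter> Q = {}" "KX \<inter> KY = {}" using KX(1) KY(1) irrefl by blast+
  then have "distinct (x @ q @ y)" using xqy by auto
  moreover have "power_path E r (b @ (x @ q @ y) @ a)" by fact
  moreover have "set (x @ q @ y) \<subseteq> V - W"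
    using xqy KX(1) KY(1) QV unfolding X_def Y_def by auto
  ultimately show ?thesis using lens by (intro exI[of _ "x @ q @ y"]) auto
qed

section \<open>Tilings by cliques and paths inside one clique\<close>

lemma clique_tiling:
  fixes \<epsilon> :: real
  assumes cliques: "\<And>X. X \<subseteq> V \<Longrightarrow> real (card X) \<ge> \<epsilon> * card V \<Longrightarrow>
      \<exists>K\<subseteq>X. card K = M \<and> pairwise E K"
    and "0 < M" "U \<subseteq> V"
  shows "\<exists>TT. finite TT \<and> pairwise disjnt TT \<and> (\<forall>T\<in>TT. T \<subseteq> U \<and> card T = M \<and> pairwise E T) \<and>
    real (card (U - \<Union>TT)) < \<epsilon> * card V"
  using \<open>U \<subseteq> V\<close>
\<comment> \<open>Cliques are removed greedily; the threshold stays relative to \<open>V\<close>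
  while \<open>U\<close> shrinks.\<close>
proof (induction "card U" arbitrary: U rule: less_induct)
  case less
  show ?case
  proof (cases "real (card U) < \<epsilon> * card V")
    case True
    then show ?thesis by (intro exI[of _ "{}"]) auto
  next
    case False
    then obtain K where K: "K \<subseteq> U" "card K = M" "pairwise E K"
      using cliques[OF less.prems] by auto
    have "finite U" using less.prems finite_V finite_subset by auto
    have "K \<noteq> {}" using K \<open>0 < M\<close> by auto
    then have "card (U - K) < card U"
      using K \<open>finite U\<close> by (intro psubset_card_mono) auto
    then obtain TT where TT: "finite TT" "pairwise disjnt TT"
      "\<forall>T\<in>TT. T \<subseteq> U - K \<and> card T = M \<and> pairwise E T"
      "real (card (U - K - \<Union>TT)) < \<epsilon> * card V"
      using less.hyps[of "U - K"] less.prems by auto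
    have "pairwise disjnt (insert K TT)"
      using TT(2,3) by (auto simp: pairwise_insert disjnt_def)
    moreover have "U - \<Union>(insert K TT) = U - K - \<Union>TT" by auto
    ultimately show ?thesis
      using TT K by (intro exI[of _ "insert K TT"]) auto
  qed
qed

text \<open>Only \<open>4 * r\<close> vertices of \<open>K\<close> enter, which is what
  \<open>popular_subset\<close> needs for \<open>c = 1/2\<close>. The proportion thus depends on
  \<open>r\<close> alone, and the tile size can be chosen after it.\<close>

lemma clique_with_common_nbrs:
  assumes deg: "\<And>v. v \<in> V \<Longrightarrow> real (card {u \<in> V. E v u}) \<ge> 1/2 * card V"
    and K: "K \<subseteq> V" "4 * r \<le> card K" and "0 < r"
  shows "\<exists>a. length a = r \<and> distinct a \<and> set a \<subseteq> K \<and>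
    real (card (common_nbrs (set a) V)) \<ge> 1 / 2 ^ (4 * r + 2) * card V"
proof -
  obtain K' where K': "K' \<subseteq> K" "card K' = 4 * r" "finite K'"
    using obtain_subset_with_card_n[OF K(2)] by blast
  have "\<exists>Q\<subseteq>K'. card Q = r \<and>
      real (card (common_nbrs Q V)) \<ge> (1/2) / 2 ^ (card K' + 1) * card V"
    using K K' deg \<open>0 < r\<close> finite_V by (intro popular_subset) auto
  then obtain Q where Q: "Q \<subseteq> K'" "card Q = r"
    "real (card (common_nbrs Q V)) \<ge> 1 / 2 ^ (4 * r + 2) * card V"
    using K' by auto
  obtain a where "set a = Q" "distinct a"
    using finite_distinct_list[of Q] Q K' finite_subset by metis
  then show ?thesis using Q K' distinct_card[of a] by (intro exI[of _ a]) auto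
qed

lemma clique_path:
  assumes "pairwise E (set a \<union> set b \<union> I)" "finite I"
    and "distinct (a @ b)" "I \<inter> (set a \<union> set b) = {}"
  shows "\<exists>m. distinct m \<and> set m = I \<and> power_path E r (a @ m @ b)"
proof -
  obtain m where m: "set m = I" "distinct m" using finite_distinct_list assms(2) by blast
  have "power_path E r (a @ m @ b)"
    using assms m by (intro power_path_clique) (auto simp: Un_ac)
  then show ?thesis using m by blast
qed

text \<open>Placed between \<open>r\<close> of its neighbours and \<open>r\<close> others,
  \<open>v\<close> is within distance \<open>r\<close> of neighbours only. The rest of the clique is
  visited beforehand in any order.\<close>

lemma clique_path_insert:
  assumes cl: "pairwise E (set a \<union> set b \<union> I)" and "finite I"
    and dist: "distinct (a @ b)" "I \<inter> (set a \<union> set b) = {}"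
    and v: "v \<notin> I" "2 * r \<le> card {u \<in> I. E v u}"
  shows "\<exists>m. distinct m \<and> set m = insert v I \<and> power_path E r (a @ m @ b)"
proof -
  have "r \<le> card {u \<in> I. E v u}" using v(2) by simp
  then obtain P where P: "P \<subseteq> {u \<in> I. E v u}" "card P = r" "finite P"
    by (rule obtain_subset_with_card_n)
  have "r \<le> card ({u \<in> I. E v u} - P)"
    using v(2) P by (simp add: card_Diff_subset)
  then obtain P' where P': "P' \<subseteq> {u \<in> I. E v u} - P" "card P' = r" "finite P'"
    by (rule obtain_subset_with_card_n)
  obtain p p' i1 where p: "set p = P" "distinct p" and p': "set p' = P'" "distinct p'"
    and i1: "set i1 = I - P - P'" "distinct i1"
    using finite_distinct_list[OF P(3)] finite_distinct_list[OF P'(3)]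
      finite_distinct_list[of "I - P - P'"] \<open>finite I\<close> by auto
  have len: "length p = r" "length p' = r" using p p' P P' distinct_card by metis+
  have 1: "power_path E r ((a @ i1) @ p)"
    using p i1 P P' dist cl by (intro power_path_clique) (auto intro: pairwise_subset[OF cl])
  have 3: "power_path E r (p' @ b)"
    using p' P P' dist by (intro power_path_clique) (auto intro: pairwise_subset[OF cl])
  have "pairwise E (P \<union> P')" using P P' by (intro pairwise_subset[OF cl]) auto
  then have "pairwise E (insert v (P \<union> P'))"
    using P P' sym by (auto simp: pairwise_insert)
  then have 2: "power_path E r (p @ [v] @ p')"
    using p p' P P' v(1) by (intro power_path_clique) auto
  have "power_path E r (p @ ([v] @ p') @ b)"
    using power_path_join[of E r "p @ [v]" p' b] 2 3 len by simp
  then have "power_path E r (a @ (i1 @ p @ [v] @ p') @ b)"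
    using power_path_join[OF 1, of "[v] @ p' @ b"] len by simp
  moreover have "distinct (i1 @ p @ [v] @ p')" using p p' i1 P P' v(1) by auto
  moreover have "set (i1 @ p @ [v] @ p') = insert v I" using p p' i1 P P' by auto
  ultimately show ?thesis by blast
qed

text \<open>The constants are chosen in the order \<open>r\<close>, \<open>R\<close>,
  \<open>M\<close>, \<open>\<epsilon>\<close>. Among the hypotheses,
  \<open>10 * real r \<le> \<alpha> * M\<close> keeps the vertices forbidden to a connecting path
  few, \<open>56 * r \<le> M\<close> bounds the neighbours lost to ends, connections and poor tiles,
  and \<open>8 * real M * \<epsilon> \<le> 1\<close> makes the leftover vertices few compared with
  the tiles available to them.\<close>

theorem hamilton_power_path:
  fixes r M R :: nat and \<eta> \<alpha> \<epsilon> :: real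
  defines "\<alpha> \<equiv> 1 / 2 ^ (4 * r + 2)"
  assumes deg: "\<And>v. v \<in> V \<Longrightarrow> real (card {u \<in> V. E v u}) \<ge> (1/2 + \<eta>) * card V"
    and cliques: "\<And>X. X \<subseteq> V \<Longrightarrow> real (card X) \<ge> \<epsilon> * card V \<Longrightarrow>
      \<exists>K\<subseteq>X. card K = M \<and> pairwise E K"
    and r: "0 < r" "real r \<le> \<epsilon> * card V"
    and \<eta>: "0 < \<eta>" "\<eta> \<le> 1/2"
    and R: "2 * real r \<le> \<eta> / 4 * real R"
    and M: "2 * real R \<le> \<eta> / 4 * real M" "10 * real r \<le> \<alpha> * M" "56 * r \<le> M"
    and \<epsilon>: "0 < \<epsilon>" "\<epsilon> \<le> \<eta>" "\<epsilon> \<le> \<eta> * \<alpha> / 2 ^ (M + 5)" "8 * real M * \<epsilon> \<le> 1"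
  shows "\<exists>ws. distinct ws \<and> set ws = V \<and> power_path E r (ws @ take r ws)"
proof -
  define n where "n = card V"
  have n: "0 < n" using r \<epsilon> unfolding n_def by (cases "card V = 0") auto
  have \<alpha>: "0 < \<alpha>" by (simp add: \<alpha>_def)
  have M0: "0 < M" using M(3) r by simp
  have half_deg: "real (card {u \<in> V. E v u}) \<ge> 1/2 * card V" if "v \<in> V" for v
  proof -
    have "1/2 * real (card V) \<le> (1/2 + \<eta>) * card V" using \<eta> by (intro mult_right_mono) auto
    then show ?thesis using deg[OF that] by linarith
  qed

  \<comment> \<open>Tiling all but few vertices by cliques\<close>
  obtain TT where TT: "finite TT" "pairwise disjnt TT"
      "\<And>K. K \<in> TT \<Longrightarrow> K \<subseteq> V \<and> card K = M \<and> pairwise E K"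
      "real (card (V - \<Union>TT)) < \<epsilon> * n"
    using clique_tiling[where \<epsilon> = \<epsilon> and U = V, OF cliques M0 subset_refl] unfolding n_def by auto
  define t where "t = card TT"
  obtain T where T: "bij_betw T {0..<t} TT"
    using ex_bij_betw_nat_finite[OF TT(1)] t_def by auto
  have TTT: "TT = T ` {..<t}" using T by (auto simp: bij_betw_def lessThan_atLeast0)
  have Tin: "T i \<in> TT" if "i < t" for i using that TTT by auto
  have Ti: "T i \<subseteq> V" "card (T i) = M" "pairwise E (T i)" "finite (T i)" if "i < t" for i
    using TT(3)[OF Tin[OF that]] finite_V finite_subset by auto
  have Tdisj: "T i \<inter> T j = {}" if "i < t" "j < t" "i \<noteq> j" for i j
  proof -
    have "T i \<noteq> T j" using that T by (auto simp: bij_betw_def inj_on_def)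
    then show ?thesis using TT(2) Tin that by (auto simp: pairwise_def disjnt_def)
  qed
  have "card (\<Union>TT) = (\<Sum>K\<in>TT. card K)"
    using TT finite_V by (intro card_Union_disjoint) (auto intro: finite_subset)
  also have "\<dots> = t * M" using TT(3) by (simp add: t_def)
  finally have "t * M = card (\<Union>TT)" by simp
  also have "\<dots> \<le> n" unfolding n_def using TT(3) finite_V by (intro card_mono) auto
  finally have tM: "t * M \<le> n" .
  have \<epsilon>M: "\<epsilon> * n * M \<le> n / 8"
    using mult_right_mono[OF \<epsilon>(4), of "real n"] by (simp add: field_simps)
  have \<epsilon>8: "\<epsilon> * n \<le> n / 8"
  proof -
    have "\<epsilon> * n * 1 \<le> \<epsilon> * n * M" using M0 \<epsilon>(1) by (intro mult_left_mono) auto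
    then show ?thesis using \<epsilon>M by simp
  qed
  have t0: "0 < t"
  proof (rule ccontr)
    assume "\<not> 0 < t"
    then have "TT = {}" using TTT by simp
    then show False using TT(4) \<epsilon>8 n by (simp add: n_def[symmetric])
  qed

  \<comment> \<open>The two ends of every tile\<close>
  define ends where "ends i a b \<longleftrightarrow> length a = r \<and> length b = r \<and> distinct (a @ b) \<and>
      set a \<union> set b \<subseteq> T i \<and> real (card (common_nbrs (set a) V)) \<ge> \<alpha> * n \<and>
      real (card (common_nbrs (set b) V)) \<ge> \<alpha> * n" for i a b
  have "\<exists>a b. ends i a b" if i: "i < t" for i
  proof -
    obtain a where a: "length a = r" "distinct a" "set a \<subseteq> T i"
      "real (card (common_nbrs (set a) V)) \<ge> \<alpha> * n"
      using clique_with_common_nbrs[OF half_deg Ti(1)[OF i] _ r(1)] Ti(2)[OF i] M(3)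
      unfolding \<alpha>_def n_def by auto
    have "card (T i - set a) = M - r"
      using a Ti[OF i] distinct_card[of a] by (simp add: card_Diff_subset)
    then have "4 * r \<le> card (T i - set a)" using M(3) by simp
    moreover have "T i - set a \<subseteq> V" using Ti(1)[OF i] by auto
    ultimately obtain b where b: "length b = r" "distinct b" "set b \<subseteq> T i - set a"
      "real (card (common_nbrs (set b) V)) \<ge> \<alpha> * n"
      using clique_with_common_nbrs[OF half_deg _ _ r(1)] unfolding \<alpha>_def n_def by blast
    show ?thesis using a b unfolding ends_def by (intro exI[of _ a] exI[of _ b]) auto
  qed
  then obtain a b where "\<And>i. i < t \<Longrightarrow> ends i (a i) (b i)" by metis
  then have
    ab: "\<And>i. i < t \<Longrightarrow> length (a i) = r \<and> length (b i) = r \<and> distinct (a i @ b i) \<and>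
      set (a i) \<union> set (b i) \<subseteq> T i \<and> real (card (common_nbrs (set (a i)) V)) \<ge> \<alpha> * n \<and>
      real (card (common_nbrs (set (b i)) V)) \<ge> \<alpha> * n"
    unfolding ends_def .
  \<comment> \<open>Reduction modulo \<open>t\<close> makes the first tile the successor of the last
    one, so the chain of tiles closes up.\<close>
  define a' where "a' i = a (i mod t)" for i
  have a'_eq: "a' i = a i" if "i < t" for i using that by (simp add: a'_def)
  have mod_t: "i mod t < t" for i using t0 by simp
  define D where "D = (\<Union>i<t. set (a i) \<union> set (b i))"
  have finD: "finite D" by (simp add: D_def)
  have "card D \<le> (\<Sum>i<t. card (set (a i) \<union> set (b i)))"
    unfolding D_def by (intro card_UN_le) simp
  also have "\<dots> \<le> (\<Sum>i<t. 2 * r)"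
  proof (rule sum_mono)
    fix i assume "i \<in> {..<t}"
    then show "card (set (a i) \<union> set (b i)) \<le> 2 * r"
      using ab[of i] card_Un_le[of "set (a i)" "set (b i)"] card_length[of "a i"] card_length[of "b i"]
      by auto
  qed
  finally have cardD: "card D \<le> 2 * r * t" by (simp add: mult.commute)

  \<comment> \<open>Disjoint connecting paths between consecutive tiles\<close>
  define P where "P i c \<longleftrightarrow> length c = 3 * r \<and> distinct c \<and> set c \<subseteq> V \<and>
    power_path E r (b i @ c @ a' (Suc i))" for i c
  \<comment> \<open>The bound \<open>5 * r * t\<close> covers all ends, at most
    \<open>2 * r * t\<close> vertices, and all connecting paths, \<open>3 * r\<close> vertices each.
    As \<open>t * M \<le> n\<close>, it is a small fraction of \<open>n\<close>.\<close>
  have conn: "\<exists>c. P i c \<and> set c \<inter> W = {}" if i: "i \<in> {..<t}" and W: "finite W" "card W \<le> 5 * r * t" for i W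
  proof -
    have "card W * M \<le> 5 * r * t * M" using W(2) by (rule mult_le_mono1)
    also have "\<dots> \<le> 5 * r * n" using tM by simp
    finally have WM: "real (card W) * M \<le> 5 * r * real n"
      by (simp only: of_nat_mult[symmetric] of_nat_le_iff)
    also have "\<dots> \<le> (\<alpha> * M / 2) * n" using M(2) by (intro mult_right_mono) auto
    finally have "real (card W) * M \<le> (\<alpha> / 2 * n) * M" by (simp add: mult_ac)
    then have W1: "real (card W) \<le> \<alpha> / 2 * n" using M0 by simp
    have "\<eta> / 4 * real R \<le> 1 * real R" using \<eta> by (intro mult_right_mono) auto
    then have "10 * real r \<le> \<eta> * M" using R M(1) by linarith
    then have "5 * real r * n \<le> (\<eta> * M / 2) * n" by (intro mult_right_mono) auto
    then have "real (card W) * M \<le> (\<eta> / 2 * n) * M" using WM by (simp add: mult_ac)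
    then have W2: "real (card W) \<le> \<eta> / 2 * n" using M0 by simp
    have cl: "pairwise E (set (b i))" "pairwise E (set (a' (Suc i)))"
      using ab[of i] ab[OF mod_t, of "Suc i"] Ti(3)[of i] Ti(3)[OF mod_t, of "Suc i"] i unfolding a'_def
      by (auto intro: pairwise_subset)
    have "\<exists>c. length c = 3 * r \<and> distinct c \<and> set c \<subseteq> V - W \<and> power_path E r (b i @ c @ a' (Suc i))"
      using ab[of i] ab[OF mod_t, of "Suc i"] i cl
      by (intro connecting_path[OF deg cliques r \<eta> \<alpha> \<epsilon>(1) R M(1) \<epsilon>(2,3)
            W1[unfolded n_def] W2[unfolded n_def] W(1)])
        (auto simp: a'_def n_def)
    then show ?thesis unfolding P_def by blast
  qed
  have "\<exists>c. (\<forall>i\<in>{..<t}. P i (c i) \<and> set (c i) \<inter> D = {}) \<and> disjoint_family_on (set \<circ> c) {..<t}"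
    using conn finD cardD
    by (intro greedy_disjoint_choice[where w = "5 * r * t" and m = "3 * r"])
      (auto simp: P_def distinct_card)
  then obtain c where "\<forall>i\<in>{..<t}. P i (c i) \<and> set (c i) \<inter> D = {}" "disjoint_family_on (set \<circ> c) {..<t}"
    by (elim exE conjE) (rule that)
  then have c: "\<And>i. i < t \<Longrightarrow> P i (c i)" "\<And>i. i < t \<Longrightarrow> set (c i) \<inter> D = {}"
    "\<And>i j. i < t \<Longrightarrow> j < t \<Longrightarrow> i \<noteq> j \<Longrightarrow> set (c i) \<inter> set (c j) = {}"
    by (auto simp: disjoint_family_on_def)
  define C where "C = (\<Union>i<t. set (c i))"
  have "card C \<le> (\<Sum>i<t. card (set (c i)))" unfolding C_def by (intro card_UN_le) simp
  also have "\<dots> \<le> (\<Sum>i<t. 3 * r)"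
    using c(1) unfolding P_def by (intro sum_mono) (simp add: distinct_card)
  finally have cardC: "card C \<le> 3 * r * t" by (simp add: mult.commute)
  have finC: "finite C" and CV: "C \<subseteq> V" using c(1) unfolding C_def P_def by auto
  have CD: "C \<inter> D = {}" using c(2) unfolding C_def by auto

  \<comment> \<open>A tile of its own for every leftover vertex\<close>
  define I where "I i = T i - D - C" for i
  \<comment> \<open>Connecting paths may also have used vertices outside the tiles; these need no
    further treatment.\<close>
  define L where "L = V - \<Union>TT - C"
  have finL: "finite L" using finite_V unfolding L_def by simp
  have cardL: "real (card L) \<le> \<epsilon> * n"
  proof -
    have "card L \<le> card (V - \<Union>TT)" using finite_V unfolding L_def by (intro card_mono) auto
    then show ?thesis using TT(4) by linarith
  qed
  define Q where "Q v i \<longleftrightarrow> i < t \<and> 2 * r \<le> card {u \<in> I i. E v u}" for v i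
  \<comment> \<open>Of the at least \<open>n / 2\<close> neighbours of \<open>v\<close>, at most
    \<open>7 * (r * t) \<le> n / 8\<close> lie in \<open>D\<close>, in \<open>C\<close> or in
    interiors offering fewer than \<open>2 * r\<close>, and at most \<open>n / 8\<close> lie outside
    the tiles. The tiles of \<open>F\<close> hold the other \<open>n / 4\<close>, with at most
    \<open>M\<close> in each, while \<open>card L * M \<le> n / 8\<close>.\<close>
  have rich: "card L < card {i. Q v i}" if v: "v \<in> L" for v
  proof -
    define F where "F = {i. Q v i}"
    have Ft: "F \<subseteq> {..<t}" unfolding F_def Q_def by auto
    have finF: "finite F" using Ft finite_subset by auto
    let ?A = "\<Union>i\<in>F. T i" and ?B = "\<Union>i\<in>{..<t} - F. {u \<in> I i. E v u}" and ?U = "V - \<Union>TT"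
    have "{u \<in> V. E v u} \<subseteq> ?A \<union> ?B \<union> D \<union> C \<union> ?U" unfolding I_def TTT by auto
    moreover have finA: "finite ?A" using Ti(4) Ft finF by auto
    moreover have finB: "finite ?B" using Ti(4) unfolding I_def by auto
    ultimately have "card {u \<in> V. E v u} \<le> card (?A \<union> ?B \<union> D \<union> C \<union> ?U)"
      using finD finC finite_V by (intro card_mono) auto
    also have "\<dots> \<le> card ?A + card ?B + card D + card C + card ?U"
      by (meson card_Un_le add_le_mono1 order_trans)
    finally have tot: "card {u \<in> V. E v u} \<le> card ?A + card ?B + card D + card C + card ?U" .
    have "card ?A \<le> (\<Sum>i\<in>F. card (T i))" by (rule card_UN_le[OF finF])
    also have "\<dots> = (\<Sum>i\<in>F. M)" using Ti(2) Ft by (intro sum.cong) auto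
    finally have cA: "card ?A \<le> card F * M" by simp
    have "card ?B \<le> (\<Sum>i\<in>{..<t} - F. card {u \<in> I i. E v u})" by (intro card_UN_le) simp
    also have "\<dots> \<le> (\<Sum>i\<in>{..<t} - F. 2 * r)" by (intro sum_mono) (auto simp: F_def Q_def)
    also have "\<dots> \<le> t * (2 * r)" using card_mono[of "{..<t}" "{..<t} - F"] by simp
    finally have cB: "card ?B \<le> 2 * r * t" by (simp add: mult.commute)
    have "56 * r * t \<le> M * t" by (rule mult_le_mono1[OF M(3)])
    then have "56 * (r * t) \<le> n" using tM by (simp only: mult.assoc mult.commute[of M t])
    then have rt: "7 * real (r * t) \<le> n / 8" by linarith
    have "real n / 2 \<le> real (card {u \<in> V. E v u})"
      using half_deg[of v] v unfolding L_def n_def by simp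
    also have "\<dots> \<le> real (card F * M) + 7 * real (r * t) + card ?U"
    proof -
      have "card {u \<in> V. E v u} \<le> card F * M + 7 * (r * t) + card ?U"
        using tot cA cB cardD cardC by (simp add: mult_ac)
      then show ?thesis by linarith
    qed
    finally have "real n / 4 \<le> real (card F) * M"
      using rt TT(4) \<epsilon>8 by simp
    moreover have "real (card L) * M \<le> \<epsilon> * n * M" using cardL by (intro mult_right_mono) auto
    ultimately have "real (card L) * M < real (card F) * M" using \<epsilon>M n by linarith
    then have "card L < card F" using M0 by simp
    then show ?thesis unfolding F_def .
  qed
  \<comment> \<open>Greedy choice with singletons gives an injective assignment of tiles, since
    every leftover vertex has more than \<open>card L\<close> suitable ones.\<close>
  have "\<exists>f. (\<forall>v\<in>L. Q v (f v) \<and> {f v} \<inter> {} = {}) \<and> disjoint_family_on ((\<lambda>i. {i}) \<circ> f) L"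
  proof (rule greedy_disjoint_choice[where w = "card L" and m = 1])
    fix v and W :: "nat set" assume v: "v \<in> L" and W: "finite W" "card W \<le> card L"
    have "\<not> {i. Q v i} \<subseteq> W"
      using rich[OF v] W card_mono[of W "{i. Q v i}"] by linarith
    then show "\<exists>i. Q v i \<and> {i} \<inter> W = {}" by blast
  qed (use finL in auto)
  then obtain f where "\<forall>v\<in>L. Q v (f v) \<and> {f v} \<inter> {} = {}" "disjoint_family_on ((\<lambda>i. {i}) \<circ> f) L"
    by (elim exE conjE) (rule that)
  then have f: "\<And>v. v \<in> L \<Longrightarrow> Q v (f v)" "inj_on f L"
    by (auto simp: disjoint_family_on_def inj_on_def)

  \<comment> \<open>Running through a single tile\<close>
  have D_tile: "T i \<inter> D = set (a i) \<union> set (b i)" if i: "i < t" for i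
  proof -
    have "T i \<inter> (set (a j) \<union> set (b j)) = {}" if "j < t" "j \<noteq> i" for j
      using Tdisj[OF i that(1)] that ab[OF that(1)] by blast
    then show ?thesis using ab[OF i] i unfolding D_def by blast
  qed
  define fills where "fills i m \<longleftrightarrow> distinct m \<and> set m = I i \<union> {v \<in> L. f v = i} \<and>
      power_path E r (a i @ m @ b i)" for i m
  have "\<exists>m. fills i m" if i: "i < t" for i
  proof -
    have cl: "pairwise E (set (a i) \<union> set (b i) \<union> I i)"
      using ab[OF i] unfolding I_def by (intro pairwise_subset[OF Ti(3)[OF i]]) auto
    have finI: "finite (I i)" using Ti(4)[OF i] unfolding I_def by simp
    have dis: "I i \<inter> (set (a i) \<union> set (b i)) = {}" using i unfolding I_def D_def by auto
    have dab: "distinct (a i @ b i)" using ab[OF i] by simp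
    show ?thesis
    proof (cases "\<exists>v\<in>L. f v = i")
      case True
      then obtain v where v: "v \<in> L" "f v = i" by auto
      \<comment> \<open>Injectivity of \<open>f\<close> sends at most one leftover vertex to each
        tile.\<close>
      then have "I i \<union> {v \<in> L. f v = i} = insert v (I i)" using f(2) by (auto simp: inj_on_def)
      moreover have "v \<notin> I i" using v(1) i unfolding L_def I_def TTT by auto
      moreover have "2 * r \<le> card {u \<in> I i. E v u}" using f(1)[OF v(1)] v(2) unfolding Q_def by simp
      ultimately show ?thesis using clique_path_insert[OF cl finI dab dis] unfolding fills_def by metis
    next
      case False
      then have "I i \<union> {v \<in> L. f v = i} = I i" by auto
      then show ?thesis using clique_path[OF cl finI dab dis] unfolding fills_def by metis
    qed
  qed
  then obtain m where "\<And>i. i < t \<Longrightarrow> fills i (m i)" by metis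
  then have m: "\<And>i. i < t \<Longrightarrow> distinct (m i)"
      "\<And>i. i < t \<Longrightarrow> set (m i) = I i \<union> {v \<in> L. f v = i}"
      "\<And>i. i < t \<Longrightarrow> power_path E r (a i @ m i @ b i)"
    unfolding fills_def by auto

  \<comment> \<open>Assembling the segments and closing the cycle\<close>
  define S where "S i = a' i @ m i @ b i @ c i" for i
  define ws where "ws = concat (map S [0..<t])"
  have setS: "set (S i) = (T i \<inter> D) \<union> I i \<union> {v \<in> L. f v = i} \<union> set (c i)" if "i < t" for i
    using that m(2) D_tile[OF that] unfolding S_def a'_eq[OF that] by auto
  have LTT: "L \<inter> T i = {}" if "i < t" for i using that unfolding L_def TTT by auto
  have "distinct ws" unfolding ws_def
  proof (rule distinct_concat_upt)
    fix i assume i: "i < t"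
    have "I i \<inter> D = {}" "I i \<inter> C = {}" "L \<inter> C = {}" "set (c i) \<subseteq> C" using i
      unfolding I_def L_def C_def by auto
    moreover have "set (a i) \<union> set (b i) \<subseteq> D" "set (a i) \<union> set (b i) \<subseteq> T i"
      using i ab[OF i] unfolding D_def by auto
    moreover have "distinct (c i)" using c(1)[OF i] unfolding P_def by simp
    ultimately show "distinct (S i)"
      using ab[OF i] m(1,2)[OF i] CD LTT[OF i] unfolding S_def a'_eq[OF i] by auto
  next
    fix i j assume ij: "i < j" "j < t"
    then have i: "i < t" by simp
    \<comment> \<open>A vertex of \<open>S k\<close> determines \<open>k\<close>: through its
      connecting path if it lies in \<open>C\<close>, through \<open>f\<close> if it lies in
      \<open>L\<close>, and through its tile otherwise.\<close>
    have sub: "x \<in> set (c k) \<or> x \<notin> C \<and> (x \<in> L \<and> f x = k \<or> x \<notin> L \<and> x \<in> T k)"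
      if "x \<in> set (S k)" "k < t" for x k
    proof -
      have "I k \<inter> C = {}" "I k \<subseteq> T k" "L \<inter> C = {}" unfolding I_def L_def by auto
      then show ?thesis using that(1) CD LTT[OF that(2)] unfolding setS[OF that(2)] by blast
    qed
    have cC: "set (c k) \<subseteq> C" if "k < t" for k using that unfolding C_def by auto
    show "set (S i) \<inter> set (S j) = {}"
    proof (rule ccontr)
      assume "set (S i) \<inter> set (S j) \<noteq> {}"
      then obtain x where "x \<in> set (S i)" "x \<in> set (S j)" by blast
      then show False
        using sub[of x i] sub[of x j] i ij cC[OF i] cC[OF ij(2)] c(3)[OF i ij(2)] Tdisj[OF i ij(2)]
        by blast
    qed
  qed
  moreover have "set ws = V"
  proof
    show "set ws \<subseteq> V"
    proof
      fix x assume "x \<in> set ws"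
      then obtain i where i: "i < t" "x \<in> set (S i)" unfolding ws_def by auto
      then show "x \<in> V" using Ti(1)[OF i(1)] c(1)[OF i(1)] unfolding setS[OF i(1)] I_def L_def P_def by blast
    qed
    show "V \<subseteq> set ws"
    proof
      fix x assume x: "x \<in> V"
      have "\<exists>i<t. x \<in> set (S i)"
      proof (cases "x \<in> C")
        case True
        then show ?thesis using setS unfolding C_def by auto
      next
        case nC: False
        show ?thesis
        proof (cases "x \<in> \<Union>TT")
          case True
          then obtain i where "i < t" "x \<in> T i" unfolding TTT by auto
          then show ?thesis using setS nC unfolding I_def by blast
        next
          case False
          then have "x \<in> L" using x nC unfolding L_def by simp
          then have "f x < t" using f(1) unfolding Q_def by simp
          then show ?thesis using setS \<open>x \<in> L\<close> by blast
        qed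
      qed
      then show "x \<in> set ws" unfolding ws_def by auto
    qed
  qed
  moreover have "power_path E r (ws @ a' t)"
    unfolding ws_def S_def
  proof (rule power_path_concat)
    show "r \<le> length (a' i)" for i using ab[OF mod_t] by (simp add: a'_def)
    fix i assume i: "i < t"
    have "power_path E r ((a i @ m i) @ b i)" using m(3)[OF i] by simp
    moreover have "power_path E r (b i @ c i @ a' (Suc i))" using c(1)[OF i] unfolding P_def by simp
    ultimately show "power_path E r (a' i @ (m i @ b i @ c i) @ a' (Suc i))"
      using power_path_join[of E r "a i @ m i" "b i" "c i @ a' (Suc i)"] ab[OF i] a'_eq[OF i] by simp
  qed (rule t0)
  \<comment> \<open>As \<open>t mod t = 0\<close>, the end that follows the last segment is the one
    that opens \<open>ws\<close>.\<close>
  moreover have "a' t = take r ws"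
  proof -
    have "ws = a 0 @ m 0 @ b 0 @ c 0 @ concat (map S [1..<t])"
      unfolding ws_def using t0 a'_eq[of 0] by (simp add: upt_conv_Cons S_def)
    then show ?thesis using ab[OF t0] by (simp add: a'_def)
  qed
  ultimately show ?thesis by auto
qed

end

section \<open>Cliques from local density\<close>

definition adj :: "'a graph \<Rightarrow> 'a \<Rightarrow> 'a \<Rightarrow> bool" where
  "adj G u v \<longleftrightarrow> {u, v} \<in> edges G"

lemma adj_irrefl: "simple_graph G \<Longrightarrow> \<not> adj G u u"
  unfolding simple_graph_def adj_def by fastforce

lemma adj_sym: "adj G u v \<Longrightarrow> adj G v u"
  unfolding adj_def by (simp add: insert_commute)

lemma edge_as_pair:
  assumes "simple_graph G" "e \<in> edges G"
  obtains u v where "e = {u, v}" "u \<in> verts G" "v \<in> verts G"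
proof -
  have "card e = 2" "e \<subseteq> verts G" using assms unfolding simple_graph_def by auto
  then show thesis using that unfolding card_2_iff by auto
qed

lemma degree_eq_card_nbrs:
  assumes "simple_graph G"
  shows "degree G v = card {u \<in> verts G. adj G v u}"
proof -
  have "bij_betw (\<lambda>u. {v, u}) {u \<in> verts G. adj G v u} {e \<in> edges G. v \<in> e}"
    unfolding bij_betw_def
  proof
    show "inj_on (\<lambda>u. {v, u}) {u \<in> verts G. adj G v u}"
      by (auto simp: inj_on_def doubleton_eq_iff)
    show "(\<lambda>u. {v, u}) ` {u \<in> verts G. adj G v u} = {e \<in> edges G. v \<in> e}"
    proof
      show "{e \<in> edges G. v \<in> e} \<subseteq> (\<lambda>u. {v, u}) ` {u \<in> verts G. adj G v u}"
      proof
        fix e assume e: "e \<in> {e \<in> edges G. v \<in> e}"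
        then obtain x y where xy: "e = {x, y}" "x \<in> verts G" "y \<in> verts G"
          using edge_as_pair[OF assms] by blast
        then have "e = {v, if v = x then y else x}" using e by auto
        then show "e \<in> (\<lambda>u. {v, u}) ` {u \<in> verts G. adj G v u}"
          using e xy unfolding adj_def by (intro image_eqI[where x = "if v = x then y else x"]) auto
      qed
    qed (auto simp: adj_def)
  qed
  then show ?thesis unfolding degree_def by (simp add: bij_betw_same_card)
qed

text \<open>The sum counts every edge twice; the bound without the factor \<open>1/2\<close> is all
  that the density argument needs.\<close>

lemma card_induced_edges_le:
  assumes "simple_graph G" "finite X"
  shows "card (edges (induced_subgraph G X)) \<le> (\<Sum>v\<in>X. card {u \<in> X. adj G v u})"
proof -
  have "edges (induced_subgraph G X) \<subseteq> (\<lambda>(v, u). {v, u}) ` (SIGMA v:X. {u \<in> X. adj G v u})"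
  proof
    fix e assume e: "e \<in> edges (induced_subgraph G X)"
    then have "e \<in> edges G" unfolding induced_subgraph_def by simp
    then obtain u v where "e = {u, v}" using edge_as_pair[OF assms(1)] by metis
    then show "e \<in> (\<lambda>(v, u). {v, u}) ` (SIGMA v:X. {u \<in> X. adj G v u})"
      using e unfolding induced_subgraph_def adj_def by auto
  qed
  then have "card (edges (induced_subgraph G X)) \<le> card (SIGMA v:X. {u \<in> X. adj G v u})"
    using assms(2) by (intro surj_card_le) auto
  also have "\<dots> = (\<Sum>v\<in>X. card {u \<in> X. adj G v u})" using assms(2) by simp
  finally show ?thesis .
qed

lemma dense_graph_mono:
  assumes "dense_graph \<rho>' d G" "\<rho>' \<le> \<rho>"
  shows "dense_graph \<rho> d G"
  unfolding dense_graph_def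
proof (intro allI impI)
  fix X assume "X \<subseteq> verts G"
  then have "d * real (card X choose 2) - \<rho>' * (real (card (verts G)))\<^sup>2
      \<le> real (card (edges (induced_subgraph G X)))"
    using assms(1) unfolding dense_graph_def by blast
  moreover have "\<rho>' * (real (card (verts G)))\<^sup>2 \<le> \<rho> * (real (card (verts G)))\<^sup>2"
    using assms(2) by (intro mult_right_mono) auto
  ultimately show "d * real (card X choose 2) - \<rho> * (real (card (verts G)))\<^sup>2
      \<le> real (card (edges (induced_subgraph G X)))" by linarith
qed

text \<open>Write \<open>x\<close> for \<open>card X\<close>. If all these degrees were smaller,
  \<open>X\<close> would span at most \<open>d / 8 * (x * x)\<close> edges, while density forces at
  least \<open>(d / 4 - d / 16) * (x * x)\<close>. The hypothesis \<open>large\<close> gives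
  \<open>2 \<le> x\<close>, so that the binomial coefficient is at least a quarter of the
  square.\<close>

lemma dense_graph_high_degree:
  assumes G: "simple_graph G" "dense_graph \<rho> d G"
    and pos: "0 < d" "0 < \<epsilon>" and \<rho>: "\<rho> \<le> d * \<epsilon>\<^sup>2 / 16"
    and X: "X \<subseteq> verts G" "real (card X) \<ge> \<epsilon> * card (verts G)"
    and large: "2 \<le> \<epsilon> * card (verts G)"
  shows "\<exists>v\<in>X. real (card {u \<in> X. adj G v u}) \<ge> d * \<epsilon> / 8 * card (verts G)"
proof (rule ccontr)
  define n where "n = real (card (verts G))"
  define x where "x = real (card X)"
  assume "\<not> ?thesis"
  then have small: "\<And>v. v \<in> X \<Longrightarrow> real (card {u \<in> X. adj G v u}) \<le> d * \<epsilon> / 8 * n"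
    unfolding n_def by force
  have finX: "finite X" using G(1) X(1) finite_subset unfolding simple_graph_def by blast
  have x: "2 \<le> x" "\<epsilon> * n \<le> x" using X(2) large unfolding x_def n_def by linarith+
  have n: "0 < n" using large pos unfolding n_def by (cases "card (verts G) = 0") auto
  have "real (card X choose 2) = x * (x - 1) / 2"
  proof -
    have "1 \<le> card X" using x unfolding x_def by simp
    then show ?thesis unfolding x_def by (simp add: choose_two real_of_nat_div of_nat_diff)
  qed
  moreover have "x / 2 \<le> x - 1" using x by simp
  then have "x * (x / 2) \<le> x * (x - 1)" using x by (intro mult_left_mono) auto
  ultimately have "x\<^sup>2 / 4 \<le> real (card X choose 2)" by (simp add: power2_eq_square)
  then have "d * (x\<^sup>2 / 4) \<le> d * real (card X choose 2)" using pos by (intro mult_left_mono) auto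
  also have "\<dots> \<le> card (edges (induced_subgraph G X)) + \<rho> * n\<^sup>2"
    using G(2) X(1) unfolding dense_graph_def n_def by (smt (verit))
  also have "\<dots> \<le> real (\<Sum>v\<in>X. card {u \<in> X. adj G v u}) + d * \<epsilon>\<^sup>2 / 16 * n\<^sup>2"
    using card_induced_edges_le[OF G(1) finX] \<rho>
    by (intro add_mono mult_right_mono) (auto simp del: of_nat_sum)
  also have "real (\<Sum>v\<in>X. card {u \<in> X. adj G v u}) \<le> (\<Sum>v\<in>X. d * \<epsilon> / 8 * n)"
    unfolding of_nat_sum by (intro sum_mono small)
  also have "\<dots> = d / 8 * (\<epsilon> * n * x)" by (simp add: x_def)
  also have "\<dots> \<le> d / 8 * (x * x)" using pos x by (intro mult_left_mono mult_right_mono) auto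
  also have "d * \<epsilon>\<^sup>2 / 16 * n\<^sup>2 = d / 16 * ((\<epsilon> * n) * (\<epsilon> * n))" by (simp add: power2_eq_square)
  also have "\<dots> \<le> d / 16 * (x * x)" using pos x n by (intro mult_left_mono mult_mono) auto
  finally have "d * (x * x) * 4 \<le> d * (x * x) * 3" by (simp add: power2_eq_square)
  moreover have "0 < d * (x * x)" using pos x by simp
  ultimately show False by simp
qed

text \<open>A vertex of high degree inside \<open>X\<close> is set aside, and the induction
  continues in its neighbourhood within \<open>X\<close> with \<open>d * \<epsilon> / 8\<close> for
  \<open>\<epsilon>\<close>. Density is always that of \<open>G\<close> itself, so nothing has to be
  inherited by smaller sets.\<close>

lemma dense_graph_cliques:
  fixes d \<epsilon> :: real
  assumes "0 < d" "0 < \<epsilon>"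
  shows "\<exists>\<rho>>0. \<exists>n0. \<forall>G :: 'a graph. simple_graph G \<and> dense_graph \<rho> d G \<and> n0 \<le> card (verts G) \<longrightarrow>
    (\<forall>X\<subseteq>verts G. real (card X) \<ge> \<epsilon> * card (verts G) \<longrightarrow>
      (\<exists>K\<subseteq>X. card K = m \<and> pairwise (adj G) K))"
  using \<open>0 < \<epsilon>\<close>
proof (induction m arbitrary: \<epsilon>)
  case 0
  show ?case by (intro exI[of _ 1]) (auto intro!: exI[of _ "{}"])
next
  case (Suc m)
  have "0 < d * \<epsilon> / 8" using Suc.prems assms by simp
  from Suc.IH[OF this] obtain \<rho> n0 where IH: "0 < \<rho>"
    "\<And>(G :: 'a graph) X. simple_graph G \<Longrightarrow> dense_graph \<rho> d G \<Longrightarrow> n0 \<le> card (verts G) \<Longrightarrow>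
      X \<subseteq> verts G \<Longrightarrow> real (card X) \<ge> d * \<epsilon> / 8 * card (verts G) \<Longrightarrow>
      \<exists>K\<subseteq>X. card K = m \<and> pairwise (adj G) K"
    by blast
  \<comment> \<open>The minimum serves the induction hypothesis, through
    \<open>dense_graph_mono\<close>, as well as \<open>dense_graph_high_degree\<close>.\<close>
  define \<rho>' where "\<rho>' = min \<rho> (d * \<epsilon>\<^sup>2 / 16)"
  define n1 where "n1 = max n0 (nat \<lceil>2 / \<epsilon>\<rceil>)"
  have "\<exists>K\<subseteq>X. card K = Suc m \<and> pairwise (adj G) K"
    if G: "simple_graph G" "dense_graph \<rho>' d G" "n1 \<le> card (verts G)"
      and X: "X \<subseteq> verts G" "real (card X) \<ge> \<epsilon> * card (verts G)" for G :: "'a graph" and X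
  proof -
    have "2 / \<epsilon> \<le> card (verts G)" using G(3) unfolding n1_def by linarith
    then have large: "2 \<le> \<epsilon> * card (verts G)" using Suc.prems by (simp add: field_simps)
    have "\<rho>' \<le> d * \<epsilon>\<^sup>2 / 16" unfolding \<rho>'_def by simp
    from dense_graph_high_degree[OF G(1,2) assms(1) Suc.prems this X large]
    obtain v where v: "v \<in> X" "real (card {u \<in> X. adj G v u}) \<ge> d * \<epsilon> / 8 * card (verts G)"
      by blast
    have "dense_graph \<rho> d G" using dense_graph_mono[OF G(2)] unfolding \<rho>'_def by simp
    then obtain K where K: "K \<subseteq> {u \<in> X. adj G v u}" "card K = m" "pairwise (adj G) K"
      using IH(2)[OF G(1) _ _ _ v(2)] G(3) X(1) unfolding n1_def by auto
    have "K \<subseteq> verts G" using K(1) X(1) by auto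
    then have "finite K" using G(1) finite_subset unfolding simple_graph_def by auto
    moreover have "v \<notin> K" using K(1) adj_irrefl[OF G(1)] by auto
    ultimately have "card (insert v K) = Suc m" using K(2) by simp
    moreover have "adj G v u \<and> adj G u v" if "u \<in> K" for u
      using K(1) that adj_sym[of G v u] by auto
    then have "pairwise (adj G) (insert v K)"
      using K(3) by (auto simp: pairwise_insert)
    moreover have "insert v K \<subseteq> X" using K(1) v(1) by auto
    ultimately show ?thesis by blast
  qed
  moreover have "0 < \<rho>'" using IH(1) assms Suc.prems unfolding \<rho>'_def by simp
  ultimately show ?case by blast
qed

section \<open>Back to cycles in graphs, and the choice of constants\<close>

lemma cycle_of_cyclic_power_path:
  assumes "distinct ws" "set ws \<subseteq> verts G" "3 \<le> length ws"
    and "0 < q" "r \<le> q" "q \<le> length ws" "power_path (adj G) q (ws @ take q ws)"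
  shows "is_cycle G ws" "subgraph (cycle_power r ws) G"
proof -
  have E: "{ws ! i, ws ! ((i + j) mod length ws)} \<in> edges G"
    if "i < length ws" "1 \<le> j" "j \<le> q" for i j
    using cycle_of_power_path[OF assms(7,6), of i j] that unfolding adj_def by simp
  \<comment> \<open>The edges of the cycle itself are the case \<open>j = 1\<close>, available since
    \<open>q\<close> is positive.\<close>
  then show "is_cycle G ws"
    using assms E[where j = 1] unfolding is_cycle_def by simp
  show "subgraph (cycle_power r ws) G"
    using assms E unfolding subgraph_def cycle_power_def by force
qed

theorem theorem12:
  fixes r s :: nat and d \<eta> :: real
  assumes "d > 0" and "\<eta> > 0"
  shows "\<exists>\<rho>::real. \<exists>n0::nat. \<rho> > 0 \<and> n0 > 0 \<and>
    (\<forall>(G :: 'a graph) n.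
       simple_graph G \<and> card (verts G) = n \<and> n \<ge> n0 \<and> dense_graph \<rho> d G \<and>
       real (min_degree G) \<ge> (1/2 + \<eta>) * real n \<longrightarrow>
         (\<exists>ws. hamilton_cycle G ws \<and> subgraph (cycle_power r ws) G) \<and>
         (\<forall>n'::int. int n - int s \<le> n' \<and> n' \<le> int n \<longrightarrow>
            (\<exists>ws. is_cycle G ws \<and> int (card (set ws)) = n' \<and> subgraph (cycle_power r ws) G)))"
proof -
  \<comment> \<open>For \<open>r = 0\<close> a power path carries no edges, so the construction runs
    with at least the first power.\<close>
  define q where "q = max 1 r"
  \<comment> \<open>Half of the surplus degree is reserved for the discarded vertices; the cap at
    \<open>1/2\<close> is required by \<open>hamilton_power_path\<close>.\<close>
  define \<theta> where "\<theta> = min \<eta> 1 / 2"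
  define \<alpha> where "\<alpha> = 1 / (2::real) ^ (4 * q + 2)"
  have q: "0 < q" "r \<le> q" by (auto simp: q_def)
  have \<theta>: "0 < \<theta>" "\<theta> \<le> 1/2" "2 * \<theta> \<le> \<eta>" using assms by (auto simp: \<theta>_def)
  have \<alpha>: "0 < \<alpha>" by (simp add: \<alpha>_def)
  obtain R :: nat where R: "2 * real q / (\<theta> / 4) \<le> R" using real_arch_simple by blast
  define M where "M = max (nat \<lceil>2 * real R / (\<theta> / 4)\<rceil>) (max (nat \<lceil>10 * real q / \<alpha>\<rceil>) (56 * q))"
  have "2 * real R / (\<theta> / 4) \<le> M" "10 * real q / \<alpha> \<le> M" and M56: "56 * q \<le> M"
    unfolding M_def by linarith+
  then have RM: "2 * real q \<le> \<theta> / 4 * real R" "2 * real R \<le> \<theta> / 4 * real M" "10 * real q \<le> \<alpha> * M"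
    using R \<theta> \<alpha> by (auto simp: field_simps)
  have M0: "0 < real M" using M56 q by simp
  define \<epsilon> where "\<epsilon> = min \<theta> (min (\<theta> * \<alpha> / 2 ^ (M + 5)) (1 / (8 * real M)))"
  have \<epsilon>: "0 < \<epsilon>" "\<epsilon> \<le> \<theta>" "\<epsilon> \<le> \<theta> * \<alpha> / 2 ^ (M + 5)" "\<epsilon> \<le> 1 / (8 * real M)"
    using \<theta> \<alpha> M0 by (auto simp: \<epsilon>_def)
  then have \<epsilon>M: "8 * real M * \<epsilon> \<le> 1" using M0 by (simp add: field_simps)
  \<comment> \<open>The remaining set \<open>U\<close> will contain at least half of all vertices,
    so \<open>\<epsilon> * card U\<close> is at least
    \<open>\<epsilon> / 2 * card (verts G)\<close>.\<close>
  have "0 < \<epsilon> / 2" using \<epsilon> by simp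
  from dense_graph_cliques[OF assms(1) this, of M] obtain \<rho> n1 where \<rho>: "0 < \<rho>"
    and cliques_G: "\<forall>G :: 'a graph. simple_graph G \<and> dense_graph \<rho> d G \<and> n1 \<le> card (verts G) \<longrightarrow>
      (\<forall>X\<subseteq>verts G. real (card X) \<ge> \<epsilon> / 2 * card (verts G) \<longrightarrow>
        (\<exists>K\<subseteq>X. card K = M \<and> pairwise (adj G) K))"
    by (elim exE conjE) (rule that)
  \<comment> \<open>The entries provide, in turn: the cliques; at least half of the vertices, and at
    least three, in \<open>U\<close>; a degree loss \<open>s\<close> of at most
    \<open>\<theta> * card (verts G)\<close>; and
    \<open>q \<le> \<epsilon> * card U\<close>.\<close>
  define n0 where "n0 = Max {n1, 2 * s + 6, nat \<lceil>s / \<theta>\<rceil>, nat \<lceil>2 * q / \<epsilon>\<rceil>}"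
  have n0: "n1 \<le> n0" "2 * s + 6 \<le> n0" "nat \<lceil>s / \<theta>\<rceil> \<le> n0" "nat \<lceil>2 * q / \<epsilon>\<rceil> \<le> n0"
    unfolding n0_def by (intro Max_ge; simp)+
  have cycle: "\<exists>ws. is_cycle G ws \<and> set ws = U \<and> subgraph (cycle_power r ws) G"
    if G: "simple_graph G" "n0 \<le> card (verts G)" "dense_graph \<rho> d G"
        "real (min_degree G) \<ge> (1/2 + \<eta>) * card (verts G)"
      and U: "U \<subseteq> verts G" "card (verts G) \<le> card U + s" for G :: "'a graph" and U
  proof -
    have finV: "finite (verts G)" using G(1) unfolding simple_graph_def by simp
    have finU: "finite U" using U(1) finV finite_subset by blast
    \<comment> \<open>The locale does not confine \<open>E\<close> to \<open>V\<close>, so adjacency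
      in \<open>G\<close> is kept while the vertex set shrinks to \<open>U\<close>.\<close>
    interpret relation_graph U "adj G"
      using finU adj_irrefl[OF G(1)] adj_sym by unfold_locales
    have "s / \<theta> \<le> card (verts G)" "2 * q / \<epsilon> \<le> card (verts G)" using n0 G(2) by linarith+
    then have large: "real s \<le> \<theta> * card (verts G)" "2 * real q \<le> \<epsilon> * card (verts G)"
      using \<theta> \<epsilon> by (auto simp: field_simps)
    have UV: "card U \<le> card (verts G)" by (rule card_mono[OF finV U(1)])
    have half: "real (card (verts G)) \<le> 2 * real (card U)" "3 \<le> card U"
      using n0(2) G(2) U(2) by linarith+
    have deg: "real (card {u \<in> U. adj G v u}) \<ge> (1/2 + \<theta>) * card U" if "v \<in> U" for v
    proof -
      have "min_degree G \<le> degree G v" unfolding min_degree_def using finV that U by auto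
      also have "\<dots> = card {u \<in> verts G. adj G v u}" by (rule degree_eq_card_nbrs[OF G(1)])
      also have "\<dots> \<le> card ({u \<in> U. adj G v u} \<union> (verts G - U))"
        using finV finU by (intro card_mono) auto
      also have "\<dots> \<le> card {u \<in> U. adj G v u} + card (verts G - U)" by (rule card_Un_le)
      also have "card (verts G - U) \<le> s" using U finU by (simp add: card_Diff_subset)
      finally have "(1/2 + \<eta>) * card (verts G) \<le> real (card {u \<in> U. adj G v u}) + s"
        using G(4) by linarith
      moreover have "(1/2 + 2 * \<theta>) * card (verts G) \<le> (1/2 + \<eta>) * card (verts G)"
        using \<theta> by (intro mult_right_mono) auto
      moreover have "(1/2 + \<theta>) * card U \<le> (1/2 + \<theta>) * card (verts G)"
        using \<theta> UV by (intro mult_left_mono) auto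
      ultimately show ?thesis using large(1) by (simp add: algebra_simps)
    qed
    have cliques: "\<exists>K\<subseteq>X. card K = M \<and> pairwise (adj G) K"
      if "X \<subseteq> U" "real (card X) \<ge> \<epsilon> * card U" for X
    proof -
      have "\<epsilon> / 2 * card (verts G) \<le> \<epsilon> / 2 * (2 * card U)"
        using half \<epsilon> by (intro mult_left_mono) auto
      then have "real (card X) \<ge> \<epsilon> / 2 * card (verts G)" using that(2) by simp
      moreover have "X \<subseteq> verts G" using that(1) U(1) by simp
      moreover have "n1 \<le> card (verts G)" using n0(1) G(2) by simp
      ultimately show ?thesis using cliques_G G(1,3) by blast
    qed
    have "\<epsilon> * card (verts G) \<le> \<epsilon> * (2 * card U)" using half \<epsilon> by (intro mult_left_mono) auto
    then have qU: "real q \<le> \<epsilon> * card U" using large(2) by simp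
    also have "\<dots> \<le> 1 * real (card U)" using \<epsilon> \<theta> by (intro mult_right_mono) auto
    finally have "q \<le> card U" by simp
    obtain ws where ws: "distinct ws" "set ws = U" "power_path (adj G) q (ws @ take q ws)"
      using hamilton_power_path[OF deg cliques q(1) qU \<theta>(1,2) RM[unfolded \<alpha>_def] M56 \<epsilon>(1-3)[unfolded \<alpha>_def] \<epsilon>M]
      by blast
    have "length ws = card U" using ws distinct_card by metis
    then have "is_cycle G ws" "subgraph (cycle_power r ws) G"
      using cycle_of_cyclic_power_path[OF ws(1) _ _ q _ ws(3)] ws(2) U(1) half(2) \<open>q \<le> card U\<close> by auto
    then show ?thesis using ws(2) by blast
  qed
  show ?thesis
  proof (intro exI[of _ \<rho>] exI[of _ n0] conjI allI impI; (elim conjE)?)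
    show "0 < n0" using n0(2) by simp
  next
    fix G :: "'a graph" and n
    assume "simple_graph G" "card (verts G) = n" "n0 \<le> n" "dense_graph \<rho> d G"
      "(1/2 + \<eta>) * real n \<le> real (min_degree G)"
    note G = this
    show "\<exists>ws. hamilton_cycle G ws \<and> subgraph (cycle_power r ws) G"
      using cycle[of G "verts G"] G unfolding hamilton_cycle_def by auto
    fix n' :: int assume n': "int n - int s \<le> n'" "n' \<le> int n"
    have "nat n' \<le> card (verts G)" using n' G(2) by simp
    then obtain U where U: "U \<subseteq> verts G" "card U = nat n'" by (meson obtain_subset_with_card_n)
    \<comment> \<open>This makes \<open>nat n'\<close> lossless; it holds because \<open>n0\<close>
      exceeds \<open>s\<close>.\<close>
    have "0 \<le> n'" using n'(1) n0(2) G(3) by linarith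
    moreover have "card (verts G) \<le> card U + s" using n'(1) U(2) G(2) by linarith
    ultimately show "\<exists>ws. is_cycle G ws \<and> int (card (set ws)) = n' \<and> subgraph (cycle_power r ws) G"
      using cycle[of G U] G U by auto
  qed (rule \<rho>)
qed

end
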